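(* Let $N\ge1$ be an integer and let $U$ be the Perron–Frobenius operator of $T_N$ under $G_N$. Then: (i) For $f\in L^1(I,G_N)$, $$Uf(x)=\sum_{i\ge N}V_{N,i}(x)\,f\left(\frac{N}{x+i}\right)\quad\text{a.e.}$$ (ii) Let $\mu$ be a probability measure on $(I,\mathcal{B}_I)$ absolutely continuous with respect to Lebesgue measure $\lambda$, and let $h:=d\mu/d\lambda$. (a) Suppose $\mu(T_N^{-1}(A))=0$ whenever $\mu(A)=0$, $A\in\mathcal{B}_I$, and let $S$ be the Perron–Frobenius operator of $T_N$ under $\mu$. Then for every $f\in L^1(I,\mu)$, for $\mu$-a.e. $x\in I$, $$Sf(x)=\frac{N}{h(x)}\sum_{i\ge N}\frac{h\left(\frac{N}{x+i}\right)}{(x+i)^2}f\left(\frac{N}{x+i}\right)=\frac{U\hat f(x)}{(x+N)h(x)},$$ where $\hat f(x):=(x+N)f(x)h(x)$; and for any $n\ge1$, $$S^nf(x)=\frac{U^n\hat f(x)}{(x+N)h(x)}.$$ (b) Let $K$ be the Perron–Frobenius operator of $T_N$ under $\lambda$. Then for every $f\in L^1(I,\lambda)$, a.e. in $I$, $$Kf(x)=\sum_{i\ge N}\frac{N}{(x+i)^2}f\left(\frac{N}{x+i}\right),$$ and for any $n\ge1$, $K^nf(x)=\dfrac{U^n\hat f(x)}{x+N}$, where $\hat f(x):=(x+N)f(x)$. (c) For any $n\in\mathbb{N}_+$ and $A\in\mathcal{B}_I$, $$\mu\left(T_N^{-n}(A)\right)=\int_AU^nf(x)\,dG_N(x),$$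 where $f(x):=\left(\log\frac{N+1}{N}\right)(x+N)h(x)$ for $x\in I$.
   Context: $I=[0,1]$ with Borel $\sigma$-algebra $\mathcal{B}_I$; $\mathbb{N}_+=\{1,2,\dots\}$. $T_N:I\to I$ is defined by $T_N(x)=N/x-\lfloor N/x\rfloor$ for $x\neq0$ and $T_N(0)=0$. $G_N$ is the probability measure $G_N(A)=\frac{1}{\log\frac{N+1}{N}}\int_A\frac{dx}{x+N}$, which is $T_N$-invariant. For integers $i\ge N$, $V_{N,i}(x):=\dfrac{x+N}{(x+i)(x+i+1)}$. For a probability measure $\mu$ on $(I,\mathcal{B}_I)$ such that $\mu(T_N^{-1}(A))=0$ whenever $\mu(A)=0$, let $L^1(I,\mu)=\{f:I\to\mathbb{C}:\int_I|f|\,d\mu<\infty\}$; the Perron–Frobenius operator of $T_N$ under $\mu$ is the bounded linear operator $P$ on $L^1(I,\mu)$ determined by $$\int_APf\,d\mu=\int_{T_N^{-1}(A)}f\,d\mu\quad\text{for all }A\in\mathcal{B}_I,\ f\in L^1(I,\mu).$$ *)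

theory Defs
  imports "HOL-Probability.Probability_Measure"
begin

definition unit_borel :: "real measure" where
  "unit_borel = restrict_space borel {0..1}"

definition unit_lebesgue :: "real measure" where
  "unit_lebesgue = restrict_space lborel {0..1}"

definition cf_map :: "nat \<Rightarrow> real \<Rightarrow> real" where
  "cf_map N x = (if x = 0 then 0 else real N / x - of_int \<lfloor>real N / x\<rfloor>)"

definition cf_measure :: "nat \<Rightarrow> real measure" where
  "cf_measure N =
     density unit_lebesgue (\<lambda>x. ennreal (1 / ln ((real N + 1) / real N) * (1 / (x + real N))))"

definition cf_weight :: "nat \<Rightarrow> nat \<Rightarrow> real \<Rightarrow> real" where
  "cf_weight N i x = (x + real N) / ((x + real i) * (x + real i + 1))"

definition nonsingular :: "'a measure \<Rightarrow> ('a \<Rightarrow> 'a) \<Rightarrow> bool" where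
  "nonsingular M T \<longleftrightarrow>
     (\<forall>A\<in>sets M. emeasure M A = 0 \<longrightarrow> emeasure M (T -` A \<inter> space M) = 0)"

text \<open>
  Elements of \<open>L\<^sup>1\<close> are represented by integrable functions, so an operator on \<open>L\<^sup>1\<close> is
  represented by a choice of one version of \<open>P f\<close> for every integrable \<open>f\<close>. The identity below
  determines the class of \<open>P f\<close>; the lemmas that follow show that it also forces \<open>P\<close> to be a
  well-defined bounded linear operator on classes, and that a representative exists whenever
  \<open>T\<close> is nonsingular.
\<close>

definition perron_frobenius ::
    "'a measure \<Rightarrow> ('a \<Rightarrow> 'a) \<Rightarrow> (('a \<Rightarrow> complex) \<Rightarrow> ('a \<Rightarrow> complex)) \<Rightarrow> bool" where
  "perron_frobenius M T P \<longleftrightarrow>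
     (\<forall>f. integrable M f \<longrightarrow>
        integrable M (P f) \<and>
        (\<forall>A\<in>sets M. (LINT x:A|M. P f x) = (LINT x:(T -` A \<inter> space M)|M. f x)))"

lemma set_integrable_of_integrable:
  fixes f :: "'a \<Rightarrow> 'b :: {banach, second_countable_topology}"
  assumes "integrable M f" "A \<in> sets M"
  shows "set_integrable M A f"
  using integrable_mult_indicator[OF assms(2,1)] by (simp add: set_integrable_def)

lemma perron_frobenius_AE_unique:
  assumes "sigma_finite_measure M" "T \<in> measurable M M" "perron_frobenius M T P" "perron_frobenius M T Q"
    and "integrable M f" "integrable M g" "AE x in M. f x = g x"
  shows "AE x in M. P f x = Q g x"
proof (rule sigma_finite_measure.density_unique_banach[OF assms(1)])
  show "integrable M (P f)" "integrable M (Q g)"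
    using assms by (auto simp: perron_frobenius_def)
  fix A assume A: "A \<in> sets M"
  have m: "T -` A \<inter> space M \<in> sets M"
    using assms(2) A by (rule measurable_sets)
  have "(LINT x:(T -` A \<inter> space M)|M. f x) = (LINT x:(T -` A \<inter> space M)|M. g x)"
    using assms(5-7) m unfolding set_lebesgue_integral_def
    by (intro integral_cong_AE) (auto intro!: borel_measurable_scaleR borel_measurable_indicator)
  then show "(LINT x:A|M. P f x) = (LINT x:A|M. Q g x)"
    using assms A by (simp add: perron_frobenius_def)
qed

lemma perron_frobenius_AE_linear:
  assumes M: "sigma_finite_measure M" and T: "T \<in> measurable M M" and P: "perron_frobenius M T P"
    and f: "integrable M f" and g: "integrable M g"
  shows "AE x in M. P (\<lambda>x. a * f x + b * g x) x = a * P f x + b * P g x"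
proof (rule sigma_finite_measure.density_unique_banach[OF assms(1)])
  have fg: "integrable M (\<lambda>x. a * f x + b * g x)" using f g by auto
  have Pf: "integrable M (P f)" and Pg: "integrable M (P g)"
    using P f g by (auto simp: perron_frobenius_def)
  show "integrable M (P (\<lambda>x. a * f x + b * g x))"
    using P fg by (auto simp: perron_frobenius_def)
  show "integrable M (\<lambda>x. a * P f x + b * P g x)" using Pf Pg by auto
  fix A assume A: "A \<in> sets M"
  have m: "T -` A \<inter> space M \<in> sets M" using T A by (rule measurable_sets)
  have lin: "(LINT x:B|M. a * u x + b * v x) = a * (LINT x:B|M. u x) + b * (LINT x:B|M. v x)"
    if "integrable M u" "integrable M v" "B \<in> sets M" for u v :: "'a \<Rightarrow> complex" and B
    using set_integrable_of_integrable[OF that(1,3)] set_integrable_of_integrable[OF that(2,3)]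
    by (subst set_integral_add) auto
  have "(LINT x:A|M. P (\<lambda>x. a * f x + b * g x) x)
      = (LINT x:(T -` A \<inter> space M)|M. a * f x + b * g x)"
    using P fg A by (simp add: perron_frobenius_def)
  also have "\<dots> = a * (LINT x:A|M. P f x) + b * (LINT x:A|M. P g x)"
    using P f g A by (simp add: lin[OF f g m] perron_frobenius_def)
  also have "\<dots> = (LINT x:A|M. a * P f x + b * P g x)"
    by (rule lin[OF Pf Pg A, symmetric])
  finally show "(LINT x:A|M. P (\<lambda>x. a * f x + b * g x) x) = (LINT x:A|M. a * P f x + b * P g x)" .
qed

lemma norm_integral_le_of_set_integrals:
  fixes g :: "'a \<Rightarrow> real"
  assumes g: "integrable M g" and b: "\<And>A. A \<in> sets M \<Longrightarrow> \<bar>LINT x:A|M. g x\<bar> \<le> C"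
  shows "(LINT x|M. \<bar>g x\<bar>) \<le> 2 * C"
proof -
  have [measurable]: "g \<in> borel_measurable M" using g by auto
  define A B where "A = {x \<in> space M. 0 \<le> g x}" and "B = {x \<in> space M. g x < 0}"
  have A: "A \<in> sets M" and B: "B \<in> sets M" unfolding A_def B_def by auto
  have iA: "integrable M (\<lambda>x. indicator A x *\<^sub>R g x)" and iB: "integrable M (\<lambda>x. indicator B x *\<^sub>R g x)"
    by (rule integrable_mult_indicator[OF A g], rule integrable_mult_indicator[OF B g])
  have "(LINT x|M. \<bar>g x\<bar>) = (LINT x|M. indicator A x *\<^sub>R g x - indicator B x *\<^sub>R g x)"
    by (rule Bochner_Integration.integral_cong) (auto simp: A_def B_def indicator_def)
  also have "\<dots> = (LINT x:A|M. g x) - (LINT x:B|M. g x)"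
    unfolding set_lebesgue_integral_def by (rule Bochner_Integration.integral_diff[OF iA iB])
  also have "\<dots> \<le> 2 * C" using b[OF A] b[OF B] by linarith
  finally show ?thesis .
qed

lemma perron_frobenius_bounded:
  assumes T: "T \<in> measurable M M" and P: "perron_frobenius M T P" and f: "integrable M f"
  shows "(LINT x|M. norm (P f x)) \<le> 4 * (LINT x|M. norm (f x))"
proof -
  let ?C = "LINT x|M. norm (f x)"
  have Pf: "integrable M (P f)" using P f by (auto simp: perron_frobenius_def)
  have b: "norm (LINT x:A|M. P f x) \<le> ?C" if A: "A \<in> sets M" for A
  proof -
    have m: "T -` A \<inter> space M \<in> sets M" using T A by (rule measurable_sets)
    have "norm (LINT x:A|M. P f x) = norm (LINT x:(T -` A \<inter> space M)|M. f x)"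
      using P f A by (simp add: perron_frobenius_def)
    also have "\<dots> \<le> (LINT x|M. norm (indicator (T -` A \<inter> space M) x *\<^sub>R f x))"
      unfolding set_lebesgue_integral_def by (rule integral_norm_bound)
    also have "\<dots> \<le> ?C"
      using f m by (intro integral_mono integrable_norm integrable_mult_indicator)
        (auto simp: indicator_def)
    finally show ?thesis .
  qed
  have re: "(LINT x:A|M. Re (P f x)) = Re (LINT x:A|M. P f x)"
    and im: "(LINT x:A|M. Im (P f x)) = Im (LINT x:A|M. P f x)" if A: "A \<in> sets M" for A
    using integral_Re[OF integrable_mult_indicator[OF A Pf]]
      integral_Im[OF integrable_mult_indicator[OF A Pf]]
    by (simp_all add: set_lebesgue_integral_def)
  have iRe: "integrable M (\<lambda>x. Re (P f x))" and iIm: "integrable M (\<lambda>x. Im (P f x))"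
    using Pf by auto
  have "(LINT x|M. \<bar>Re (P f x)\<bar>) \<le> 2 * ?C"
    by (rule norm_integral_le_of_set_integrals[OF iRe])
      (use b re abs_Re_le_cmod order_trans in metis)
  moreover have "(LINT x|M. \<bar>Im (P f x)\<bar>) \<le> 2 * ?C"
    by (rule norm_integral_le_of_set_integrals[OF iIm])
      (use b im abs_Im_le_cmod order_trans in metis)
  moreover have "(LINT x|M. norm (P f x)) \<le> (LINT x|M. \<bar>Re (P f x)\<bar> + \<bar>Im (P f x)\<bar>)"
    using Pf iRe iIm by (intro integral_mono) (auto intro: cmod_le)
  moreover have "\<dots> = (LINT x|M. \<bar>Re (P f x)\<bar>) + (LINT x|M. \<bar>Im (P f x)\<bar>)"
    using iRe iIm by (intro Bochner_Integration.integral_add) auto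
  ultimately show ?thesis by linarith
qed

lemma nonneg_transfer_density:
  fixes f :: "'a \<Rightarrow> real"
  assumes M: "sigma_finite_measure M" and T: "T \<in> measurable M M" and ns: "nonsingular M T"
    and f: "integrable M f" and pos: "\<And>x. 0 \<le> f x"
  shows "\<exists>g. integrable M g \<and>
    (\<forall>A\<in>sets M. (LINT x:A|M. g x) = (LINT x:(T -` A \<inter> space M)|M. f x))"
proof -
  interpret sigma_finite_measure M by fact
  have [measurable]: "f \<in> borel_measurable M" using f by auto
  define D where "D = density M (\<lambda>x. ennreal (f x))"
  have TD: "T \<in> measurable D M" using T by (simp add: D_def measurable_def)
  define L where "L = distr D M T"
  have D_eq: "emeasure D B = ennreal (LINT x:B|M. f x)" if "B \<in> sets M" for B
  proof -
    have "emeasure D B = (\<integral>\<^sup>+x. ennreal (indicator B x *\<^sub>R f x) \<partial>M)"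
      unfolding D_def using that
      by (subst emeasure_density) (auto intro!: nn_integral_cong simp: indicator_def)
    also have "\<dots> = ennreal (LINT x:B|M. f x)"
      unfolding set_lebesgue_integral_def
      using integrable_mult_indicator[OF that f] pos
      by (intro nn_integral_eq_integral) auto
    finally show ?thesis .
  qed
  have L_eq: "emeasure L A = ennreal (LINT x:(T -` A \<inter> space M)|M. f x)" if A: "A \<in> sets M" for A
  proof -
    have "emeasure L A = emeasure D (T -` A \<inter> space D)"
      unfolding L_def by (rule emeasure_distr[OF TD A])
    also have "\<dots> = emeasure D (T -` A \<inter> space M)" by (simp add: D_def)
    finally show ?thesis using D_eq[OF measurable_sets[OF T A]] by simp
  qed
  have fin: "finite_measure L"
    by (rule finite_measureI) (simp add: L_eq L_def[THEN arg_cong, of space] L_eq[OF sets.top])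
  have ac: "absolutely_continuous M L"
    unfolding absolutely_continuous_def
  proof
    fix A assume A: "A \<in> null_sets M"
    have "T -` A \<inter> space M \<in> null_sets M"
      using ns A measurable_sets[OF T, of A] by (auto simp: nonsingular_def null_sets_def)
    then have "T -` A \<inter> space M \<in> null_sets D"
      using absolutely_continuousI_density[of "\<lambda>x. ennreal (f x)" M]
      by (auto simp: D_def absolutely_continuous_def)
    then have "emeasure L A = 0"
      using A TD by (simp add: L_def emeasure_distr null_sets_def D_def)
    then show "A \<in> null_sets L" using A by (auto simp: null_sets_def L_def)
  qed
  have sL: "sets L = sets M" by (simp add: L_def)
  obtain g where g: "g \<in> borel_measurable M" "AE x in M. RN_deriv M L x = ennreal (g x)"
    "\<And>x. 0 \<le> g x"
    using real_RN_deriv[OF fin ac sL] by blast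
  have Lg: "L = density M (\<lambda>x. ennreal (g x))"
    using density_RN_deriv[OF ac sL] density_cong[of "RN_deriv M L" M "\<lambda>x. ennreal (g x)"] g by auto
  have nn: "(\<integral>\<^sup>+x. ennreal (indicator A x *\<^sub>R g x) \<partial>M) = emeasure L A" if "A \<in> sets M" for A
    unfolding Lg using that g(1)
    by (subst emeasure_density) (auto intro!: nn_integral_cong simp: indicator_def)
  have "integrable M g"
  proof (rule integrableI_nonneg)
    have "(\<integral>\<^sup>+x. ennreal (g x) \<partial>M) = emeasure L (space M)"
      using nn[OF sets.top] by (simp cong: nn_integral_cong)
    also have "\<dots> < \<infinity>" using L_eq[OF sets.top] by simp
    finally show "(\<integral>\<^sup>+x. ennreal (g x) \<partial>M) < \<infinity>" .
  qed (use g in auto)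
  moreover have "(LINT x:A|M. g x) = (LINT x:(T -` A \<inter> space M)|M. f x)" if A: "A \<in> sets M" for A
  proof -
    have "ennreal (LINT x:A|M. g x) = (\<integral>\<^sup>+x. ennreal (indicator A x *\<^sub>R g x) \<partial>M)"
      unfolding set_lebesgue_integral_def
      using integrable_mult_indicator[OF A \<open>integrable M g\<close>] g(3)
      by (intro nn_integral_eq_integral[symmetric]) auto
    also have "\<dots> = ennreal (LINT x:(T -` A \<inter> space M)|M. f x)" using nn[OF A] L_eq[OF A] by simp
    finally show ?thesis
      using g(3) pos by (simp add: set_lebesgue_integral_def integral_nonneg_AE)
  qed
  ultimately show ?thesis by blast
qed

lemma real_transfer_density:
  fixes f :: "'a \<Rightarrow> real"
  assumes M: "sigma_finite_measure M" and T: "T \<in> measurable M M" and ns: "nonsingular M T"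
    and f: "integrable M f"
  shows "\<exists>g. integrable M g \<and>
    (\<forall>A\<in>sets M. (LINT x:A|M. g x) = (LINT x:(T -` A \<inter> space M)|M. f x))"
proof -
  let ?p = "\<lambda>x. max 0 (f x)" and ?n = "\<lambda>x. max 0 (- f x)"
  have p: "integrable M ?p" and n: "integrable M ?n" using f by auto
  obtain g where g: "integrable M g"
    "\<And>A. A \<in> sets M \<Longrightarrow> (LINT x:A|M. g x) = (LINT x:(T -` A \<inter> space M)|M. ?p x)"
    using nonneg_transfer_density[OF M T ns p] by auto
  obtain h where h: "integrable M h"
    "\<And>A. A \<in> sets M \<Longrightarrow> (LINT x:A|M. h x) = (LINT x:(T -` A \<inter> space M)|M. ?n x)"
    using nonneg_transfer_density[OF M T ns n] by auto
  have fe: "f = (\<lambda>x. ?p x - ?n x)" by (auto simp: max_def)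
  have "(LINT x:A|M. g x - h x) = (LINT x:(T -` A \<inter> space M)|M. f x)" if A: "A \<in> sets M" for A
  proof -
    have m: "T -` A \<inter> space M \<in> sets M" using T A by (rule measurable_sets)
    have "(LINT x:A|M. g x - h x) = (LINT x:A|M. g x) - (LINT x:A|M. h x)"
      using set_integrable_of_integrable g(1) h(1) A by (intro set_integral_diff) blast+
    also have "\<dots> = (LINT x:(T -` A \<inter> space M)|M. ?p x - ?n x)"
      unfolding g(2)[OF A] h(2)[OF A]
      using set_integrable_of_integrable[OF p m] set_integrable_of_integrable[OF n m]
      by (intro set_integral_diff(2)[symmetric])
    finally show ?thesis using fe by metis
  qed
  then show ?thesis using g(1) h(1)
    by (intro exI[of _ "\<lambda>x. g x - h x"]) auto
qed

lemma perron_frobenius_exists: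
  assumes M: "sigma_finite_measure M" and T: "T \<in> measurable M M" and ns: "nonsingular M T"
  shows "\<exists>P. perron_frobenius M T P"
proof -
  have "\<exists>g. integrable M f \<longrightarrow> integrable M g \<and>
      (\<forall>A\<in>sets M. (LINT x:A|M. g x) = (LINT x:(T -` A \<inter> space M)|M. f x))"
    for f :: "'a \<Rightarrow> complex"
  proof (cases "integrable M f")
    case True
    obtain u where u: "integrable M u"
      "\<And>A. A \<in> sets M \<Longrightarrow> (LINT x:A|M. u x) = (LINT x:(T -` A \<inter> space M)|M. Re (f x))"
      using real_transfer_density[OF M T ns integrable_Re[OF True]] by auto
    obtain v where v: "integrable M v"
      "\<And>A. A \<in> sets M \<Longrightarrow> (LINT x:A|M. v x) = (LINT x:(T -` A \<inter> space M)|M. Im (f x))"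
      using real_transfer_density[OF M T ns integrable_Im[OF True]] by auto
    define g where "g = (\<lambda>x. Complex (u x) (v x))"
    have gi: "integrable M g"
      using u(1) v(1) unfolding g_def Complex_eq by auto
    have re: "Re (LINT x:A|M. k x) = (LINT x:A|M. Re (k x))"
      and im: "Im (LINT x:A|M. k x) = (LINT x:A|M. Im (k x))"
      if "integrable M k" "A \<in> sets M" for A and k :: "'a \<Rightarrow> complex"
      using integral_Re[OF integrable_mult_indicator[OF that(2,1)]]
        integral_Im[OF integrable_mult_indicator[OF that(2,1)]]
      by (simp_all add: set_lebesgue_integral_def)
    have "(LINT x:A|M. g x) = (LINT x:(T -` A \<inter> space M)|M. f x)" if A: "A \<in> sets M" for A
    proof -
      have m: "T -` A \<inter> space M \<in> sets M" using T A by (rule measurable_sets)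
      show ?thesis
        by (rule complex_eqI)
          (simp_all add: re[OF gi A] im[OF gi A] re[OF True m] im[OF True m] u(2)[OF A, symmetric]
            v(2)[OF A, symmetric], simp_all add: g_def)
    qed
    with gi show ?thesis by blast
  qed auto
  then show ?thesis unfolding perron_frobenius_def by metis
qed

end

theory Submission
  imports Defs "HOL-Analysis.Lebesgue_Integral_Substitution"
begin

text \<open>Under Lebesgue measure, the inverse branches \<open>x \<mapsto> N / (x + i)\<close>, \<open>i \<ge> N\<close>, map the unit interval
  onto the disjoint cells \<open>(N / (i + 1), N / i]\<close>, which exhaust \<open>(0, 1]\<close>. Substitution on every cell and
  summation over \<open>i\<close> give the explicit transfer operator under Lebesgue measure. Passing to a measure with
  density \<open>w\<close> conjugates the operator by multiplication with \<open>w\<close>; comparing the densities \<open>h\<close> and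
  \<open>1 / (x + N)\<close> yields the remaining formulas, and the iterates follow by induction.\<close>

section \<open>The unit interval as a measurable space and as a finite measure space\<close>

lemma space_unit_borel [simp]: "space unit_borel = {0..1}"
  by (simp add: unit_borel_def space_restrict_space)

lemma space_unit_lebesgue [simp]: "space unit_lebesgue = {0..1}"
  by (simp add: unit_lebesgue_def space_restrict_space)

lemma sets_unit_lebesgue [measurable_cong]: "sets unit_lebesgue = sets unit_borel"
  by (simp add: unit_lebesgue_def unit_borel_def sets_restrict_space)

lemma borel_measurable_unit_borel: "f \<in> borel_measurable borel \<Longrightarrow> f \<in> borel_measurable unit_borel"
  unfolding unit_borel_def by (rule measurable_restrict_space1)

lemma borel_measurable_unit_lebesgue: "f \<in> borel_measurable borel \<Longrightarrow> f \<in> borel_measurable unit_lebesgue"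
  unfolding unit_lebesgue_def by (intro measurable_restrict_space1) simp

lemma finite_measure_unit_lebesgue: "finite_measure unit_lebesgue"
  by (rule finite_measureI) (simp add: unit_lebesgue_def emeasure_restrict_space space_restrict_space)

lemma measurable_into_unit_borel:
  assumes "f \<in> borel_measurable unit_borel" "\<And>x. x \<in> {0..1} \<Longrightarrow> f x \<in> {0..1}"
  shows "f \<in> measurable unit_borel unit_borel"
  using assms by (subst (2) unit_borel_def, intro measurable_restrict_space2) auto

section \<open>The map, its inverse branches and its cells\<close>

lemma cf_map_in_unit: "0 \<le> cf_map N x \<and> cf_map N x \<le> 1"
  unfolding cf_map_def by (auto, linarith+)

lemma measurable_cf_map [measurable]: "cf_map N \<in> measurable unit_borel unit_borel"
proof (rule measurable_into_unit_borel)
  have "cf_map N \<in> borel_measurable borel"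
    unfolding cf_map_def[abs_def] by measurable
  then show "cf_map N \<in> borel_measurable unit_borel" by (rule borel_measurable_unit_borel)
qed (use cf_map_in_unit in auto)

abbreviation (input) cf_branch :: "nat \<Rightarrow> nat \<Rightarrow> real \<Rightarrow> real" where
  "cf_branch N i x \<equiv> real N / (x + real i)"

lemma cf_branch_in_unit:
  assumes "1 \<le> N" "N \<le> i" "x \<in> {0..1}"
  shows "cf_branch N i x \<in> {0..1}"
  using assms by (auto simp: divide_simps)

lemma measurable_cf_branch:
  assumes "1 \<le> N" "N \<le> i"
  shows "cf_branch N i \<in> measurable unit_borel unit_borel"
proof (rule measurable_into_unit_borel)
  show "cf_branch N i \<in> borel_measurable unit_borel"
    by (rule borel_measurable_unit_borel) measurable
qed (rule cf_branch_in_unit[OF assms])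

text \<open>Inverting \<open>cf_branch\<close> gives N / y = x + i, whose fractional part is x. At x
  = 1 this would be the integer i + 1 with fractional part 0, so the right endpoint has to be
  excluded.\<close>

lemma cf_map_cf_branch:
  assumes "1 \<le> N" "N \<le> i" "0 \<le> x" "x < 1"
  shows "cf_map N (cf_branch N i x) = x"
proof -
  have "\<lfloor>x + real i\<rfloor> = int i"
    using assms by (simp add: floor_eq_iff)
  then show ?thesis using assms by (auto simp: cf_map_def)
qed

text \<open>Open on the left and closed on the right because digit i means i <= N / y < i + 1, and
  taking reciprocals swaps the two ends.\<close>

abbreviation (input) cf_cell :: "nat \<Rightarrow> nat \<Rightarrow> real set" where
  "cf_cell N i \<equiv> {real N / (real i + 1) <.. real N / real i}"

lemma mem_cf_cell_iff:
  assumes "1 \<le> i" "0 < y"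
  shows "y \<in> cf_cell N i \<longleftrightarrow> \<lfloor>real N / y\<rfloor> = int i"
  using assms by (auto simp: floor_eq_iff field_simps)

lemma cf_cell_subset_unit:
  assumes "N \<le> i"
  shows "cf_cell N i \<subseteq> {0<..1}"
proof
  fix y assume y: "y \<in> cf_cell N i"
  have "0 \<le> real N / (real i + 1)" and "real N / real i \<le> 1"
    using assms by (auto simp: divide_simps)
  with y show "y \<in> {0<..1}" by (simp, linarith)
qed

lemma sets_cf_cell: "N \<le> i \<Longrightarrow> cf_cell N i \<in> sets unit_borel"
  using cf_cell_subset_unit[of N i]
  unfolding unit_borel_def sets_restrict_space by (intro image_eqI[of _ _ "cf_cell N i"]) auto

text \<open>By \<open>mem_cf_cell_iff\<close> the cells are level sets of the digit floor(N / y), so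
  a common point forces equal indices. Writing the index as N + k turns the range i >= N into a
  sequence, the form needed for countable additivity.\<close>

lemma disjoint_cf_cell: "1 \<le> N \<Longrightarrow> disjoint_family (\<lambda>k. cf_cell N (N + k))"
  unfolding disjoint_family_on_def
proof (intro ballI impI)
  fix m n :: nat assume N: "1 \<le> N" and "m \<noteq> n"
  have "m = n" if "y \<in> cf_cell N (N + m)" "y \<in> cf_cell N (N + n)" for y
  proof -
    have "0 < y" using cf_cell_subset_unit[of N "N + m"] that(1) by auto
    then have "int (N + m) = int (N + n)"
      using that N mem_cf_cell_iff[of "N + m" y N] mem_cf_cell_iff[of "N + n" y N] by simp
    then show ?thesis by simp
  qed
  with \<open>m \<noteq> n\<close> show "cf_cell N (N + m) \<inter> cf_cell N (N + n) = {}" by blast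
qed

text \<open>For 0 < y <= 1 the quotient N / y is at least N, so its floor has the form N + k and
  names the cell containing y.\<close>

lemma UN_cf_cell:
  assumes N: "1 \<le> N"
  shows "(\<Union>k. cf_cell N (N + k)) = {0<..1}"
proof
  show "(\<Union>k. cf_cell N (N + k)) \<subseteq> {0<..1}"
    by (rule UN_least) (rule cf_cell_subset_unit, simp)
  show "{0<..1} \<subseteq> (\<Union>k. cf_cell N (N + k))"
  proof
    fix y :: real assume y: "y \<in> {0<..1}"
    then have "int N \<le> \<lfloor>real N / y\<rfloor>"
      by (simp add: le_floor_iff divide_simps mult_left_le)
    then obtain k where "\<lfloor>real N / y\<rfloor> = int (N + k)"
      using zle_iff_zadd[of "int N"] by auto
    then have "y \<in> cf_cell N (N + k)" using y N by (subst mem_cf_cell_iff) auto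
    then show "y \<in> (\<Union>k. cf_cell N (N + k))" by blast
  qed
qed

section \<open>Change of variables on one cell\<close>

text \<open>The substitution theorem needs an increasing map, so it is applied to \<open>- cf_branch\<close> and the
  sign is removed by a reflection.\<close>

lemma nn_integral_cf_branch:
  assumes i: "1 \<le> i" and [measurable]: "B \<in> sets borel"
  shows "(\<integral>\<^sup>+x. indicator B (cf_branch N i x) * ennreal (real N / (x + real i)\<^sup>2) * indicator {0..1} x \<partial>lborel)
    = (\<integral>\<^sup>+y. indicator B y * indicator {real N / (real i + 1) .. real N / real i} y \<partial>lborel)"
proof -
  let ?g = "\<lambda>x. - cf_branch N i x" and ?f = "\<lambda>y::real. indicator B (- y) :: real"
  have "(\<integral>\<^sup>+y. ?f y * indicator {?g 0..?g 1} y \<partial>lborel)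
      = (\<integral>\<^sup>+x. ?f (?g x) * (real N / (x + real i)\<^sup>2) * indicator {0..1} x \<partial>lborel)"
  proof (rule nn_integral_substitution)
    show "(?g has_real_derivative real N / (x + real i)\<^sup>2) (at x)" if "x \<in> {0..1}" for x
      using that i by (auto intro!: derivative_eq_intros simp: power2_eq_square)
    show "continuous_on {0..1} (\<lambda>x. real N / (x + real i)\<^sup>2)"
      using i by (intro continuous_intros) auto
    show "set_borel_measurable borel {?g 0..?g 1} ?f"
      unfolding set_borel_measurable_def by measurable
  qed (use i in auto)
  also have "(\<integral>\<^sup>+y. ?f y * indicator {?g 0..?g 1} y \<partial>lborel)
      = (\<integral>\<^sup>+y. indicator B y * indicator {real N / (real i + 1) .. real N / real i} y \<partial>lborel)"
    by (subst nn_integral_real_affine[where c = "-1" and t = 0], measurable)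
      (auto intro!: nn_integral_cong simp: indicator_def add.commute)
  also have "(\<integral>\<^sup>+x. ?f (?g x) * (real N / (x + real i)\<^sup>2) * indicator {0..1} x \<partial>lborel)
      = (\<integral>\<^sup>+x. indicator B (cf_branch N i x) * ennreal (real N / (x + real i)\<^sup>2) * indicator {0..1} x \<partial>lborel)"
    by (intro nn_integral_cong) (simp add: indicator_def)
  finally show ?thesis by (rule sym)
qed

text \<open>The substitution formula for indicators is recast as an equality of measures. The
  general rules for \<open>distr\<close> and \<open>density\<close> then extend it to all integrable
  functions at once, without approximation by simple functions.\<close>

lemma distr_cf_branch:
  assumes N: "1 \<le> N" and i: "N \<le> i"
  shows "distr (density unit_lebesgue (\<lambda>x. ennreal (real N / (x + real i)\<^sup>2))) unit_lebesgue (cf_branch N i)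
    = density unit_lebesgue (\<lambda>y. ennreal (indicator (cf_cell N i) y))" (is "?L = ?R")
proof (rule measure_eqI)
  have [measurable]: "cf_branch N i \<in> measurable unit_borel unit_borel"
    by (rule measurable_cf_branch[OF assms])
  fix A assume "A \<in> sets ?L"
  then have A [measurable]: "A \<in> sets unit_borel" by (simp add: sets_unit_lebesgue)
  then have [measurable]: "A \<in> sets borel" and A1: "A \<subseteq> {0..1}"
    by (auto simp: unit_borel_def sets_restrict_space)
  have "emeasure ?L A = (\<integral>\<^sup>+x. ennreal (real N / (x + real i)\<^sup>2) * indicator (cf_branch N i -` A \<inter> {0..1}) x \<partial>unit_lebesgue)"
    using measurable_sets[of "cf_branch N i" unit_borel unit_borel A]
    by (subst emeasure_distr, measurable)
      (simp add: emeasure_density sets_unit_lebesgue borel_measurable_unit_lebesgue)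
  also have "\<dots> = (\<integral>\<^sup>+x. indicator A (cf_branch N i x) * ennreal (real N / (x + real i)\<^sup>2) * indicator {0..1} x \<partial>lborel)"
    unfolding unit_lebesgue_def
    by (subst nn_integral_restrict_space) (auto intro!: nn_integral_cong simp: indicator_def)
  also have "\<dots> = (\<integral>\<^sup>+y. indicator A y * indicator {real N / (real i + 1) .. real N / real i} y \<partial>lborel)"
    using N i by (intro nn_integral_cf_branch) auto
  also have "\<dots> = (\<integral>\<^sup>+y. ennreal (indicator (cf_cell N i) y) * indicator A y * indicator {0..1} y \<partial>lborel)"
    \<comment> \<open>The closed interval produced by the substitution and the half-open cell differ
      only in the left endpoint, a null set.\<close>
    using AE_lborel_singleton[of "real N / (real i + 1)"]
    by (intro nn_integral_cong_AE, eventually_elim) (use A1 in \<open>auto simp: indicator_def\<close>)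
  also have "\<dots> = (\<integral>\<^sup>+y. ennreal (indicator (cf_cell N i) y) * indicator A y \<partial>unit_lebesgue)"
    unfolding unit_lebesgue_def by (subst nn_integral_restrict_space) auto
  also have "\<dots> = emeasure ?R A"
    by (subst emeasure_density) (auto simp: sets_unit_lebesgue intro!: borel_measurable_unit_lebesgue)
  finally show "emeasure ?L A = emeasure ?R A" .
qed simp

text \<open>Both claims are read off \<open>distr_cf_branch\<close>: one side unfolds the image
  measure, the other the density. The codomain is a general Banach space since the result is applied
  to complex f and to the real function norm f.\<close>

lemma
  fixes f :: "real \<Rightarrow> 'a::{banach, second_countable_topology}"
  assumes N: "1 \<le> N" and i: "N \<le> i" and f: "integrable unit_lebesgue f"
  shows integrable_cf_branch:
      "integrable unit_lebesgue (\<lambda>x. (real N / (x + real i)\<^sup>2) *\<^sub>R f (cf_branch N i x))" (is ?th1)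
    and integral_cf_branch:
      "(LINT x|unit_lebesgue. (real N / (x + real i)\<^sup>2) *\<^sub>R f (cf_branch N i x))
        = (LINT y:cf_cell N i|unit_lebesgue. f y)" (is ?th2)
proof -
  let ?D = "density unit_lebesgue (\<lambda>x. ennreal (real N / (x + real i)\<^sup>2))"
  let ?I = "density unit_lebesgue (\<lambda>y. ennreal (indicator (cf_cell N i) y))"
  have b: "cf_branch N i \<in> measurable ?D unit_lebesgue"
    using measurable_cf_branch[OF N i]
    by (simp add: measurable_cong_sets[OF sets_unit_lebesgue sets_unit_lebesgue])
  have fm: "f \<in> borel_measurable unit_lebesgue"
    using f by (rule borel_measurable_integrable)
  have fb: "(\<lambda>x. f (cf_branch N i x)) \<in> borel_measurable unit_lebesgue"
    using measurable_compose[OF b fm] by (simp only: measurable_density_eq1)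
  have w: "(\<lambda>x. real N / (x + real i)\<^sup>2) \<in> borel_measurable unit_lebesgue"
    by (rule borel_measurable_unit_lebesgue) measurable
  have c: "cf_cell N i \<in> sets unit_lebesgue"
    using sets_cf_cell[OF i] by (simp add: sets_unit_lebesgue)
  have "integrable ?D (\<lambda>x. f (cf_branch N i x)) = integrable ?I f"
    unfolding distr_cf_branch[OF N i, symmetric] by (rule integrable_distr_eq[OF b fm, symmetric])
  then show ?th1
    using integrable_mult_indicator[OF c f] fm fb w c by (simp add: integrable_density)
  have "(LINT x|?D. f (cf_branch N i x)) = integral\<^sup>L ?I f"
    unfolding distr_cf_branch[OF N i, symmetric] by (rule integral_distr[OF b fm, symmetric])
  then show ?th2
    using fm fb w c by (simp add: integral_density set_lebesgue_integral_def)
qed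

section \<open>The explicit transfer operator under Lebesgue measure\<close>

text \<open>A partial sum is the integral of g over a finite disjoint union, hence at most the
  integral of g over the whole space.\<close>

lemma summable_set_integral_disjoint:
  fixes g :: "'a \<Rightarrow> real"
  assumes g: "integrable M g" "\<And>x. 0 \<le> g x"
    and A: "disjoint_family A" "\<And>k::nat. A k \<in> sets M"
  shows "summable (\<lambda>k. LINT x:A k|M. g x)"
proof (rule summableI_nonneg_bounded)
  show "0 \<le> (LINT x:A k|M. g x)" for k
    unfolding set_lebesgue_integral_def using g by (intro integral_nonneg_AE) auto
  have int: "integrable M (\<lambda>x. indicator (A k) x *\<^sub>R g x)" for k
    by (rule integrable_mult_indicator[OF A(2) g(1)])
  fix n
  have ind: "(\<Sum>k<n. indicator (A k) x *\<^sub>R g x) = indicator (\<Union>k<n. A k) x * g x" for x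
    using disjoint_family_on_mono[OF subset_UNIV A(1), of "{..<n}"]
    by (subst indicator_UN_disjoint) (auto simp: sum_distrib_right)
  have "(\<Sum>k<n. LINT x:A k|M. g x) = (LINT x|M. (\<Sum>k<n. indicator (A k) x *\<^sub>R g x))"
    unfolding set_lebesgue_integral_def using int by (subst Bochner_Integration.integral_sum) auto
  also have "\<dots> \<le> (LINT x|M. g x)"
    using int g by (intro integral_mono Bochner_Integration.integrable_sum)
      (auto simp only: ind intro!: mult_left_le_one_le)
  finally show "(\<Sum>k<n. LINT x:A k|M. g x) \<le> (LINT x|M. g x)" .
qed

text \<open>The scalar factor is the modulus of the derivative of the inverse branch.\<close>

definition cf_term :: "nat \<Rightarrow> (real \<Rightarrow> complex) \<Rightarrow> nat \<Rightarrow> real \<Rightarrow> complex" where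
  "cf_term N f i x = (real N / (x + real i)\<^sup>2) *\<^sub>R f (cf_branch N i x)"

text \<open>An ordered series is chosen so that termwise integration of sequences applies. Points
  where it fails to converge absolutely form a null set by \<open>AE_summable_cf_term\<close>, so
  the value there is immaterial.\<close>

definition cf_transfer :: "nat \<Rightarrow> (real \<Rightarrow> complex) \<Rightarrow> real \<Rightarrow> complex" where
  "cf_transfer N f x = (\<Sum>k. cf_term N f (N + k) x)"

lemma integrable_cf_term:
  assumes "1 \<le> N" "integrable unit_lebesgue f"
  shows "integrable unit_lebesgue (cf_term N f (N + k))"
  unfolding cf_term_def using assms by (intro integrable_cf_branch) auto

lemma integral_cf_term:
  assumes "1 \<le> N" "integrable unit_lebesgue f"
  shows "(LINT x|unit_lebesgue. cf_term N f (N + k) x) = (LINT y:cf_cell N (N + k)|unit_lebesgue. f y)"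
  unfolding cf_term_def using assms by (intro integral_cf_branch) auto

text \<open>The Jacobian factor is nonnegative, so the norm of a term is the corresponding term for
  norm f. By substitution its integral is that of norm f over one cell, and the cells are
  disjoint.\<close>

lemma summable_integral_norm_cf_term:
  assumes N: "1 \<le> N" and f: "integrable unit_lebesgue f"
  shows "summable (\<lambda>k. LINT x|unit_lebesgue. norm (cf_term N f (N + k) x))"
proof -
  have "(LINT x|unit_lebesgue. norm (cf_term N f (N + k) x))
      = (LINT y:cf_cell N (N + k)|unit_lebesgue. norm (f y))" for k
    using integral_cf_branch[OF N le_add1 integrable_norm[OF f]] by (simp add: cf_term_def)
  moreover have "summable (\<lambda>k. LINT y:cf_cell N (N + k)|unit_lebesgue. norm (f y))"
    using f disjoint_cf_cell[OF N] sets_cf_cell[OF le_add1]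
    by (intro summable_set_integral_disjoint) (auto simp: sets_unit_lebesgue)
  ultimately show ?thesis by simp
qed

text \<open>Tonelli's theorem: the norms have summable integrals, so their pointwise sum has a
  finite integral and is finite almost everywhere.\<close>

lemma AE_summable_cf_term:
  assumes N: "1 \<le> N" and f: "integrable unit_lebesgue f"
  shows "AE x in unit_lebesgue. summable (\<lambda>k. norm (cf_term N f (N + k) x))"
proof -
  note int = integrable_cf_term[OF N f]
  have [measurable]: "cf_term N f (N + k) \<in> borel_measurable unit_lebesgue" for k
    using int by (rule borel_measurable_integrable)
  have "(\<integral>\<^sup>+x. (\<Sum>k. ennreal (norm (cf_term N f (N + k) x))) \<partial>unit_lebesgue)
      = (\<Sum>k. ennreal (LINT x|unit_lebesgue. norm (cf_term N f (N + k) x)))"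
    using int by (subst nn_integral_suminf) (auto simp: nn_integral_eq_integral)
  also have "\<dots> \<noteq> \<infinity>"
    unfolding infinity_ennreal_def
    by (rule ennreal_suminf_neq_top[OF summable_integral_norm_cf_term[OF N f]]) simp
  finally have "AE x in unit_lebesgue. (\<Sum>k. ennreal (norm (cf_term N f (N + k) x))) \<noteq> \<infinity>"
    by (intro nn_integral_PInf_AE) auto
  then show ?thesis
    by eventually_elim (auto intro: summable_suminf_not_top)
qed

text \<open>Absolute convergence turns the ordered series into an unconditional sum, and the shift
  by N carries the index set to \<open>{N..}\<close>.\<close>

lemma has_sum_cf_transfer:
  assumes N: "1 \<le> N" and f: "integrable unit_lebesgue f"
  shows "AE x in unit_lebesgue. ((\<lambda>i. cf_term N f i x) has_sum cf_transfer N f x) {N..}"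
  using AE_summable_cf_term[OF N f]
proof eventually_elim
  case (elim x)
  then have "((\<lambda>k. cf_term N f (N + k) x) has_sum cf_transfer N f x) UNIV"
    unfolding cf_transfer_def
    by (intro norm_summable_imp_has_sum summable_sums summable_norm_cancel[of "\<lambda>k. cf_term N f (N + k) x"])
  moreover have "(+) N ` UNIV = {N..}"
    by (auto simp: image_def le_iff_add)
  ultimately show ?case
    using has_sum_reindex[of "(+) N" UNIV "\<lambda>i. cf_term N f i x"] by (simp add: o_def)
qed

text \<open>Used to discard 0, which lies in no cell, and 1, where \<open>cf_map\<close> does not
  invert the branches.\<close>

lemma AE_unit_lebesgue_neq: "AE x in unit_lebesgue. x \<noteq> c"
proof -
  have "AE x in lborel. x \<in> {0..1} \<longrightarrow> x \<noteq> c"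
    using AE_lborel_singleton[of c] by eventually_elim auto
  then show ?thesis unfolding unit_lebesgue_def by (subst AE_restrict_space_iff) auto
qed

lemma integrable_cf_transfer:
  assumes N: "1 \<le> N" and f: "integrable unit_lebesgue f"
  shows "integrable unit_lebesgue (cf_transfer N f)"
  unfolding cf_transfer_def
  by (rule integrable_suminf[OF integrable_cf_term[OF N f] AE_summable_cf_term[OF N f]
        summable_integral_norm_cf_term[OF N f]])

text \<open>Integrating termwise gives the integrals of f over the cells. They add up to the
  integral over (0, 1], and the remaining point 0 is null.\<close>

lemma integral_cf_transfer:
  assumes N: "1 \<le> N" and f: "integrable unit_lebesgue f"
  shows "(LINT x|unit_lebesgue. cf_transfer N f x) = (LINT x|unit_lebesgue. f x)"
proof -
  have cell: "cf_cell N (N + k) \<in> sets unit_lebesgue" for k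
    using sets_cf_cell[OF le_add1] by (simp add: sets_unit_lebesgue)
  have unit: "{0<..1} \<in> sets unit_lebesgue"
    unfolding UN_cf_cell[OF N, symmetric] using cell by (intro sets.countable_UN) auto
  have "(LINT x|unit_lebesgue. cf_transfer N f x) = (\<Sum>k. LINT y:cf_cell N (N + k)|unit_lebesgue. f y)"
    unfolding cf_transfer_def
    by (subst integral_suminf[OF integrable_cf_term[OF N f] AE_summable_cf_term[OF N f]
        summable_integral_norm_cf_term[OF N f]]) (simp add: integral_cf_term[OF N f])
  also have "\<dots> = (LINT y:(\<Union>k. cf_cell N (N + k))|unit_lebesgue. f y)"
    using cell disjoint_cf_cell[OF N] unit
    by (intro lebesgue_integral_countable_add[symmetric] set_integrable_of_integrable[OF f])
      (auto simp only: disjoint_family_on_def UN_cf_cell[OF N])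
  also have "\<dots> = (LINT y|unit_lebesgue. f y)"
    unfolding UN_cf_cell[OF N] set_lebesgue_integral_def
  proof (rule integral_cong_AE)
    show "(\<lambda>y. indicat_real {0<..1} y *\<^sub>R f y) \<in> borel_measurable unit_lebesgue"
      using f unit by (intro borel_measurable_scaleR borel_measurable_indicator) auto
    show "AE y in unit_lebesgue. indicat_real {0<..1} y *\<^sub>R f y = f y"
      using AE_unit_lebesgue_neq[of 0] AE_space by eventually_elim auto
  qed (use f in auto)
  finally show ?thesis .
qed

text \<open>Preservation of the total integral suffices once it is applied to f cut off to the
  preimage of A: for x < 1 a branch point of x lies in that preimage exactly if x is in A, so the
  cut-off leaves the series as the indicator of A.\<close>

lemma perron_frobenius_cf_transfer:
  assumes N: "1 \<le> N"
  shows "perron_frobenius unit_lebesgue (cf_map N) (cf_transfer N)"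
  unfolding perron_frobenius_def
proof (intro allI impI conjI ballI)
  fix f :: "real \<Rightarrow> complex" assume f: "integrable unit_lebesgue f"
  show Qf: "integrable unit_lebesgue (cf_transfer N f)"
    by (rule integrable_cf_transfer[OF N f])
  fix A assume A: "A \<in> sets unit_lebesgue"
  let ?B = "cf_map N -` A \<inter> space unit_lebesgue"
  have "?B \<in> sets unit_lebesgue"
    using A measurable_sets[OF measurable_cf_map, of A N] by (simp add: sets_unit_lebesgue)
  then have g: "integrable unit_lebesgue (\<lambda>y. indicator ?B y *\<^sub>R f y)"
    by (rule integrable_mult_indicator[OF _ f])
  have "(LINT x:A|unit_lebesgue. cf_transfer N f x)
      = (LINT x|unit_lebesgue. cf_transfer N (\<lambda>y. indicator ?B y *\<^sub>R f y) x)"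
    unfolding set_lebesgue_integral_def
  proof (rule integral_cong_AE)
    show "(\<lambda>x. indicat_real A x *\<^sub>R cf_transfer N f x) \<in> borel_measurable unit_lebesgue"
      using integrable_mult_indicator[OF A Qf] by auto
    show "cf_transfer N (\<lambda>y. indicator ?B y *\<^sub>R f y) \<in> borel_measurable unit_lebesgue"
      using integrable_cf_transfer[OF N g] by auto
    show "AE x in unit_lebesgue. indicat_real A x *\<^sub>R cf_transfer N f x
        = cf_transfer N (\<lambda>y. indicator ?B y *\<^sub>R f y) x"
      using AE_unit_lebesgue_neq[of 1] AE_space AE_summable_cf_term[OF N f]
    proof eventually_elim
      case (elim x)
      have "cf_term N (\<lambda>y. indicator ?B y *\<^sub>R f y) (N + k) x = indicat_real A x *\<^sub>R cf_term N f (N + k) x" for k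
        using cf_map_cf_branch[OF N le_add1, of x k] cf_branch_in_unit[OF N le_add1, of x k] elim
        by (auto simp: cf_term_def indicator_def)
      then show ?case
        using elim(3) by (simp add: cf_transfer_def suminf_scaleR_right summable_norm_cancel)
    qed
  qed
  then show "(LINT x:A|unit_lebesgue. cf_transfer N f x) = (LINT x:?B|unit_lebesgue. f x)"
    using integral_cf_transfer[OF N g] by (simp add: set_lebesgue_integral_def)
qed

section \<open>Change of density and iteration\<close>

lemma sigma_finite_unit_lebesgue: "sigma_finite_measure unit_lebesgue"
  by (rule finite_measure.axioms(1)[OF finite_measure_unit_lebesgue])

lemma cf_map_measurable_unit_lebesgue: "cf_map N \<in> measurable unit_lebesgue unit_lebesgue"
  using measurable_cf_map by (simp add: measurable_cong_sets[OF sets_unit_lebesgue sets_unit_lebesgue])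

lemma set_integral_density_complex:
  fixes f :: "'a \<Rightarrow> complex"
  assumes "w \<in> borel_measurable M" "AE x in M. 0 \<le> w x" "f \<in> borel_measurable M" "A \<in> sets M"
  shows "(LINT x:A|density M (\<lambda>x. ennreal (w x)). f x) = (LINT x:A|M. of_real (w x) * f x)"
  using assms unfolding set_lebesgue_integral_def
  by (subst integral_density) (auto simp: scaleR_conv_of_real mult_ac intro!: borel_measurable_scaleR)

lemma integrable_density_complex:
  fixes f :: "'a \<Rightarrow> complex"
  assumes "w \<in> borel_measurable M" "AE x in M. 0 \<le> w x" "f \<in> borel_measurable M"
  shows "integrable (density M (\<lambda>x. ennreal (w x))) f \<longleftrightarrow> integrable M (\<lambda>x. of_real (w x) * f x)"
  using assms by (subst integrable_density) (auto simp: scaleR_conv_of_real)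

text \<open>If \<open>P\<close> and \<open>Q\<close> are the transfer operators of one map under \<open>w M\<close> and \<open>M\<close>, then multiplication
  by \<open>w\<close> intertwines them.\<close>

lemma perron_frobenius_density:
  assumes M: "sigma_finite_measure M" and T: "T \<in> measurable M M"
    and w: "w \<in> borel_measurable M" "AE x in M. 0 \<le> w x"
    and P: "perron_frobenius (density M (\<lambda>x. ennreal (w x))) T P"
    and Q: "perron_frobenius M T Q"
    and f: "integrable (density M (\<lambda>x. ennreal (w x))) f"
  shows "AE x in M. of_real (w x) * P f x = Q (\<lambda>x. of_real (w x) * f x) x"
proof (rule sigma_finite_measure.density_unique_banach[OF M])
  have Pf: "integrable (density M (\<lambda>x. ennreal (w x))) (P f)"
    using P f by (auto simp: perron_frobenius_def)
  have fm: "f \<in> borel_measurable M" and Pfm: "P f \<in> borel_measurable M"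
    using borel_measurable_integrable[OF f] borel_measurable_integrable[OF Pf] by simp_all
  have wf: "integrable M (\<lambda>x. of_real (w x) * f x)"
    using f integrable_density_complex[OF w fm] by simp
  show "integrable M (\<lambda>x. of_real (w x) * P f x)"
    using Pf integrable_density_complex[OF w Pfm] by simp
  show "integrable M (Q (\<lambda>x. of_real (w x) * f x))"
    using Q wf by (auto simp: perron_frobenius_def)
  fix A assume A: "A \<in> sets M"
  have "(LINT x:A|M. of_real (w x) * P f x) = (LINT x:A|density M (\<lambda>x. ennreal (w x)). P f x)"
    by (rule set_integral_density_complex[OF w Pfm A, symmetric])
  also have "\<dots> = (LINT x:(T -` A \<inter> space M)|density M (\<lambda>x. ennreal (w x)). f x)"
    using P f A by (simp add: perron_frobenius_def)
  also have "\<dots> = (LINT x:(T -` A \<inter> space M)|M. of_real (w x) * f x)"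
    by (rule set_integral_density_complex[OF w fm measurable_sets[OF T A]])
  also have "\<dots> = (LINT x:A|M. Q (\<lambda>x. of_real (w x) * f x) x)"
    using Q wf A by (simp add: perron_frobenius_def)
  finally show "(LINT x:A|M. of_real (w x) * P f x) = (LINT x:A|M. Q (\<lambda>x. of_real (w x) * f x) x)" .
qed

text \<open>The outermost P pulls A back along T, and the induction hypothesis pulls that preimage
  back along \<open>T ^^ n\<close>. Integrability is carried along because the defining identity of
  P is available only for integrable arguments.\<close>

lemma perron_frobenius_funpow:
  assumes T: "T \<in> measurable M M" and P: "perron_frobenius M T P" and f: "integrable M f"
  shows "integrable M ((P ^^ n) f) \<and>
    (\<forall>A\<in>sets M. (LINT x:A|M. (P ^^ n) f x) = (LINT x:((T ^^ n) -` A \<inter> space M)|M. f x))"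
proof (induction n)
  case 0
  have "(LINT x:A \<inter> space M|M. f x) = (LINT x:A|M. f x)" if "A \<in> sets M" for A
    using sets.sets_into_space[OF that] by (simp add: Int_absorb2)
  then show ?case using f by simp
next
  case (Suc n)
  have Tn: "T ^^ n \<in> measurable M M"
    by (induction n) (use T in \<open>auto intro: measurable_comp\<close>)
  have "(LINT x:A|M. (P ^^ Suc n) f x) = (LINT x:((T ^^ Suc n) -` A \<inter> space M)|M. f x)"
    if A: "A \<in> sets M" for A
  proof -
    have "(LINT x:A|M. (P ^^ Suc n) f x) = (LINT x:(T -` A \<inter> space M)|M. (P ^^ n) f x)"
      using P Suc A by (simp add: perron_frobenius_def)
    also have "\<dots> = (LINT x:((T ^^ n) -` (T -` A \<inter> space M) \<inter> space M)|M. f x)"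
      using Suc measurable_sets[OF T A] by blast
    also have "(T ^^ n) -` (T -` A \<inter> space M) \<inter> space M = (T ^^ Suc n) -` A \<inter> space M"
      using measurable_space[OF Tn] by auto
    finally show ?thesis .
  qed
  moreover have "integrable M ((P ^^ Suc n) f)"
    using P Suc by (simp add: perron_frobenius_def)
  ultimately show ?case by blast
qed

text \<open>The operator Q mediates between P and U: by \<open>perron_frobenius_density\<close>, w P
  f = Q (w f) and v U g = Q (v g) almost everywhere. Since Q is linear and respects almost
  everywhere equality, the relation a w f = v g survives each application of the operators.\<close>

lemma perron_frobenius_density_funpow:
  assumes M: "sigma_finite_measure M" and T: "T \<in> measurable M M" and Q: "perron_frobenius M T Q"
    and w: "w \<in> borel_measurable M" "AE x in M. 0 \<le> w x"
    and P: "perron_frobenius (density M (\<lambda>x. ennreal (w x))) T P"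
    and v: "v \<in> borel_measurable M" "AE x in M. 0 \<le> v x"
    and U: "perron_frobenius (density M (\<lambda>x. ennreal (v x))) T U"
    and f: "integrable (density M (\<lambda>x. ennreal (w x))) f"
    and g: "integrable (density M (\<lambda>x. ennreal (v x))) g"
    and eq: "AE x in M. a * (of_real (w x) * f x) = of_real (v x) * g x"
  shows "AE x in M. a * (of_real (w x) * (P ^^ n) f x) = of_real (v x) * (U ^^ n) g x"
proof (induction n)
  case 0
  show ?case using eq by simp
next
  case (Suc n)
  let ?f = "(P ^^ n) f" and ?g = "(U ^^ n) g"
  have Tw: "T \<in> measurable (density M (\<lambda>x. ennreal (w x))) (density M (\<lambda>x. ennreal (w x)))"
    and Tv: "T \<in> measurable (density M (\<lambda>x. ennreal (v x))) (density M (\<lambda>x. ennreal (v x)))"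
    using T by simp_all
  have f': "integrable (density M (\<lambda>x. ennreal (w x))) ?f"
    using perron_frobenius_funpow[OF Tw P f] by blast
  have g': "integrable (density M (\<lambda>x. ennreal (v x))) ?g"
    using perron_frobenius_funpow[OF Tv U g] by blast
  have wf: "integrable M (\<lambda>x. of_real (w x) * ?f x)"
    using f' integrable_density_complex[OF w] borel_measurable_integrable[OF f'] by simp
  have vg: "integrable M (\<lambda>x. of_real (v x) * ?g x)"
    using g' integrable_density_complex[OF v] borel_measurable_integrable[OF g'] by simp
  have "AE x in M. Q (\<lambda>x. a * (of_real (w x) * ?f x)) x = Q (\<lambda>x. of_real (v x) * ?g x) x"
    by (rule perron_frobenius_AE_unique[OF M T Q Q _ vg Suc]) (use wf in auto)
  \<comment> \<open>Homogeneity is the linearity lemma with second coefficient 0.\<close>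
  moreover have "AE x in M. Q (\<lambda>x. a * (of_real (w x) * ?f x)) x = a * Q (\<lambda>x. of_real (w x) * ?f x) x"
    using perron_frobenius_AE_linear[OF M T Q wf wf, of a 0] by simp
  ultimately show ?case
    using perron_frobenius_density[OF M T w P Q f'] perron_frobenius_density[OF M T v U Q g']
  proof eventually_elim
    case (elim x)
    show ?case
      unfolding funpow.simps o_apply elim(3,4) elim(1)[symmetric] by (rule elim(2)[symmetric])
  qed
qed

text \<open>\<open>enn2real\<close> sends infinity to 0, but the derivative of a finite measure is
  finite almost everywhere, so the real version h still determines the measure.\<close>

lemma eq_density_if_AE_eq_RN_deriv:
  assumes M: "sigma_finite_measure M" and N: "finite_measure N" and ac: "absolutely_continuous M N"
    and sets: "sets N = sets M" and h: "h \<in> borel_measurable M"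
    and eq: "AE x in M. h x = enn2real (RN_deriv M N x)"
  shows "N = density M (\<lambda>x. ennreal (h x))"
proof -
  have "AE x in M. RN_deriv M N x = ennreal (h x)"
    using eq sigma_finite_measure.RN_deriv_finite[OF M finite_measure.axioms(1)[OF N] ac sets]
    by eventually_elim (simp add: top.not_eq_extremum)
  then have "density M (RN_deriv M N) = density M (\<lambda>x. ennreal (h x))"
    using h by (intro density_cong) auto
  then show ?thesis
    using sigma_finite_measure.density_RN_deriv[OF M ac sets] by simp
qed

section \<open>The density of \<open>cf_measure\<close> and the factor x + N\<close>

definition cf_density :: "nat \<Rightarrow> real \<Rightarrow> real" where
  "cf_density N x = 1 / ln ((real N + 1) / real N) * (1 / (x + real N))"

lemma cf_measure_eq: "cf_measure N = density unit_lebesgue (\<lambda>x. ennreal (cf_density N x))"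
  by (simp add: cf_measure_def cf_density_def)

lemma ln_Suc_div_pos: "1 \<le> N \<Longrightarrow> 0 < ln ((real N + 1) / real N)"
  by simp

lemma cf_density_pos: "1 \<le> N \<Longrightarrow> x \<in> {0..1} \<Longrightarrow> 0 < cf_density N x"
  unfolding cf_density_def using ln_Suc_div_pos[of N]
  by (intro mult_pos_pos divide_pos_pos) auto

lemma borel_measurable_cf_density: "cf_density N \<in> borel_measurable unit_lebesgue"
  unfolding cf_density_def[abs_def] by (rule borel_measurable_unit_lebesgue) measurable

lemma AE_cf_density_nonneg: "1 \<le> N \<Longrightarrow> AE x in unit_lebesgue. 0 \<le> cf_density N x"
  using cf_density_pos[of N] by (intro AE_I2) (simp add: less_imp_le)

text \<open>The factor x + N of the hat function cancels the denominator of the density, so that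
  only the normalising constant remains. This is why hat functions under \<open>cf_measure\<close>
  correspond to plain functions under Lebesgue measure.\<close>

lemma cf_density_mult_hat:
  assumes "1 \<le> N" "x \<in> {0..1}"
  shows "complex_of_real (cf_density N x) * (of_real (x + real N) * z)
    = of_real (1 / ln ((real N + 1) / real N)) * z"
proof -
  have "cf_density N x * (x + real N) = 1 / ln ((real N + 1) / real N)"
    using assms by (simp add: cf_density_def)
  then show ?thesis by (metis mult.assoc of_real_mult)
qed

lemma integrable_cf_measure_hat:
  fixes f :: "real \<Rightarrow> complex"
  assumes N: "1 \<le> N" and f: "integrable unit_lebesgue f"
  shows "integrable (cf_measure N) (\<lambda>x. of_real (x + real N) * f x)"
proof -
  have m: "(\<lambda>x. complex_of_real (x + real N)) \<in> borel_measurable unit_lebesgue"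
    by (rule borel_measurable_unit_lebesgue) measurable
  have "integrable unit_lebesgue (\<lambda>x. of_real (cf_density N x) * (of_real (x + real N) * f x))
      = integrable unit_lebesgue (\<lambda>x. of_real (1 / ln ((real N + 1) / real N)) * f x)"
    by (rule Bochner_Integration.integrable_cong[OF refl], rule cf_density_mult_hat[OF N]) simp
  then show ?thesis
    unfolding cf_measure_eq using f m
    by (subst integrable_density_complex[OF borel_measurable_cf_density AE_cf_density_nonneg[OF N]]) auto
qed

text \<open>Stated for the product w P f because w may vanish; division by w is postponed to points
  where it is positive.\<close>

lemma cf_transfer_has_sum:
  assumes N: "1 \<le> N" and w: "w \<in> borel_measurable unit_lebesgue" "AE x in unit_lebesgue. 0 \<le> w x"
    and P: "perron_frobenius (density unit_lebesgue (\<lambda>x. ennreal (w x))) (cf_map N) P"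
    and f: "integrable (density unit_lebesgue (\<lambda>x. ennreal (w x))) f"
  shows "AE x in unit_lebesgue.
    ((\<lambda>i. of_real (real N / (x + real i)\<^sup>2) * (of_real (w (cf_branch N i x)) * f (cf_branch N i x)))
      has_sum (of_real (w x) * P f x)) {N..}"
proof -
  have "integrable unit_lebesgue (\<lambda>x. of_real (w x) * f x)"
    using f integrable_density_complex[OF w] borel_measurable_integrable[OF f] by simp
  from has_sum_cf_transfer[OF N this]
    perron_frobenius_density[OF sigma_finite_unit_lebesgue cf_map_measurable_unit_lebesgue w P
      perron_frobenius_cf_transfer[OF N] f]
  show ?thesis
    by eventually_elim (simp only: cf_term_def scaleR_conv_of_real)
qed

text \<open>An instance of \<open>perron_frobenius_density_funpow\<close> comparing w with the
  density of \<open>cf_measure\<close>; the constant a is the normalising constant c left over in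
  \<open>cf_density_mult_hat\<close>.\<close>

lemma cf_transfer_funpow_hat:
  assumes N: "1 \<le> N" and U: "perron_frobenius (cf_measure N) (cf_map N) U"
    and w: "w \<in> borel_measurable unit_lebesgue" "AE x in unit_lebesgue. 0 \<le> w x"
    and P: "perron_frobenius (density unit_lebesgue (\<lambda>x. ennreal (w x))) (cf_map N) P"
    and f: "integrable (density unit_lebesgue (\<lambda>x. ennreal (w x))) f"
  shows "AE x in unit_lebesgue. of_real ((x + real N) * w x) * (P ^^ n) f x
    = (U ^^ n) (\<lambda>x. of_real (x + real N) * (of_real (w x) * f x)) x"
proof -
  define c where "c = 1 / ln ((real N + 1) / real N)"
  let ?g = "\<lambda>x. of_real (x + real N) * (of_real (w x) * f x)"
  have wf: "integrable unit_lebesgue (\<lambda>x. of_real (w x) * f x)"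
    using f integrable_density_complex[OF w] borel_measurable_integrable[OF f] by simp
  have "AE x in unit_lebesgue. of_real c * (of_real (w x) * f x) = of_real (cf_density N x) * ?g x"
    unfolding c_def by (rule AE_I2, rule cf_density_mult_hat[OF N, symmetric]) simp
  then have "AE x in unit_lebesgue. of_real c * (of_real (w x) * (P ^^ n) f x)
      = of_real (cf_density N x) * (U ^^ n) ?g x"
    using integrable_cf_measure_hat[OF N wf] U unfolding cf_measure_eq
    by (intro perron_frobenius_density_funpow[OF sigma_finite_unit_lebesgue cf_map_measurable_unit_lebesgue
          perron_frobenius_cf_transfer[OF N] w P borel_measurable_cf_density AE_cf_density_nonneg[OF N] _ f])
  with AE_space show ?thesis
  proof eventually_elim
    case (elim x)
    then have "of_real (cf_density N x) * (of_real (x + real N) * (of_real (w x) * (P ^^ n) f x))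
        = of_real (cf_density N x) * (U ^^ n) ?g x"
      unfolding c_def by (subst cf_density_mult_hat[OF N]) auto
    moreover have "cf_density N x \<noteq> 0"
      using cf_density_pos[OF N, of x] elim(1) by simp
    ultimately show ?case
      by (simp add: mult.assoc del: of_real_add)
  qed
qed

text \<open>The function under \<open>U ^^ n\<close> is the density of \<mu> with respect to
  \<open>cf_measure\<close>. Its integral over the n-th preimage of A is therefore the \<mu>-measure
  of that preimage, and \<open>perron_frobenius_funpow\<close> moves the integral to A.\<close>

lemma measure_eq_cf_transfer_funpow:
  assumes N: "1 \<le> N" and U: "perron_frobenius (cf_measure N) (cf_map N) U"
    and w: "w \<in> borel_measurable unit_lebesgue" "AE x in unit_lebesgue. 0 \<le> w x"
    and \<mu>: "\<mu> = density unit_lebesgue (\<lambda>x. ennreal (w x))" "finite_measure \<mu>"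
    and A: "A \<in> sets unit_borel"
  shows "complex_of_real (measure \<mu> ((cf_map N ^^ n) -` A \<inter> {0..1}))
    = (LINT x:A|cf_measure N. (U ^^ n) (\<lambda>x. of_real (ln ((real N + 1) / real N) * (x + real N) * w x)) x)"
proof -
  let ?f = "\<lambda>x. complex_of_real (ln ((real N + 1) / real N) * (x + real N) * w x)"
  let ?B = "(cf_map N ^^ n) -` A \<inter> {0..1}"
  have T: "cf_map N \<in> measurable (cf_measure N) (cf_measure N)"
    using cf_map_measurable_unit_lebesgue by (simp add: cf_measure_eq)
  have "cf_map N ^^ n \<in> measurable unit_lebesgue unit_lebesgue"
    by (induction n) (use cf_map_measurable_unit_lebesgue in \<open>auto intro: measurable_comp\<close>)
  from measurable_sets[OF this, of A] have B: "?B \<in> sets unit_lebesgue"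
    using A by (simp add: sets_unit_lebesgue)
  \<comment> \<open>As \<mu> is finite, the constant 1 is integrable, which makes w itself Lebesgue
    integrable.\<close>
  have one: "integrable \<mu> (\<lambda>x. 1 :: complex)"
    using \<mu>(2) by (rule finite_measure.integrable_const)
  then have wi: "integrable unit_lebesgue (\<lambda>x. complex_of_real (w x))"
    unfolding \<mu>(1) by (subst (asm) integrable_density_complex[OF w]) auto
  have f: "integrable (cf_measure N) ?f"
    using integrable_cf_measure_hat[OF N, of "\<lambda>x. of_real (ln ((real N + 1) / real N)) * complex_of_real (w x)"] wi
    by (simp add: mult_ac)
  have fm: "?f \<in> borel_measurable unit_lebesgue"
    using borel_measurable_integrable[OF f] by (simp add: cf_measure_eq)
  have "(LINT x:A|cf_measure N. (U ^^ n) ?f x) = (LINT x:?B|cf_measure N. ?f x)"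
    using perron_frobenius_funpow[OF T U f, of n] A by (simp add: cf_measure_eq sets_unit_lebesgue)
  also have "\<dots> = (LINT x:?B|unit_lebesgue. of_real (cf_density N x) * ?f x)"
    unfolding cf_measure_eq
    by (rule set_integral_density_complex[OF borel_measurable_cf_density AE_cf_density_nonneg[OF N] fm B])
  also have "\<dots> = (LINT x:?B|unit_lebesgue. of_real (w x) * 1)"
  proof (rule set_lebesgue_integral_cong[OF B], intro allI impI)
    fix x assume "x \<in> ?B"
    then have "cf_density N x * (ln ((real N + 1) / real N) * (x + real N) * w x) = w x"
      using ln_Suc_div_pos[OF N] N by (simp add: cf_density_def)
    then show "complex_of_real (cf_density N x) * ?f x = of_real (w x) * 1"
      by (metis of_real_mult mult.right_neutral)
  qed
  also have "\<dots> = (LINT x:?B|\<mu>. 1)"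
    unfolding \<mu>(1) by (rule set_integral_density_complex[OF w _ B, symmetric]) simp
  also have "\<dots> = (LINT x|\<mu>. complex_of_real (indicator ?B x))"
    unfolding set_lebesgue_integral_def by (simp add: scaleR_conv_of_real)
  also have "\<dots> = of_real (measure \<mu> ?B)"
    by (simp add: \<mu>(1) Int_absorb2)
  finally show ?thesis by simp
qed

section \<open>Assembly of the formulas for U, S, K and the measures of preimages\<close>

theorem proposition4p1:
  fixes N :: nat and U :: "(real \<Rightarrow> complex) \<Rightarrow> real \<Rightarrow> complex"
  assumes "N \<ge> 1"
    and "perron_frobenius (cf_measure N) (cf_map N) U"
  shows
    "(\<forall>f :: real \<Rightarrow> complex. integrable (cf_measure N) f \<longrightarrow>
        (AE x in unit_lebesgue.
          ((\<lambda>i. of_real (cf_weight N i x) * f (real N / (x + real i))) has_sum U f x) {N..}))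
     \<and>
     (\<forall>(\<mu> :: real measure) (h :: real \<Rightarrow> real).
        prob_space \<mu> \<and> sets \<mu> = sets unit_borel \<and> absolutely_continuous unit_lebesgue \<mu> \<and>
        h \<in> borel_measurable unit_borel \<and>
        (AE x in unit_lebesgue. h x = enn2real (RN_deriv unit_lebesgue \<mu> x)) \<longrightarrow>
          \<comment> \<open>(a)\<close>
          (nonsingular \<mu> (cf_map N) \<longrightarrow>
             (\<forall>S. perron_frobenius \<mu> (cf_map N) S \<longrightarrow>
                (\<forall>f :: real \<Rightarrow> complex. integrable \<mu> f \<longrightarrow>
                   (let fhat = (\<lambda>x. of_real (x + real N) * f x * of_real (h x)) in
                     (AE x in \<mu>.
                        (\<lambda>i. of_real (h (real N / (x + real i)) / (x + real i)\<^sup>2)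
                               * f (real N / (x + real i))) summable_on {N..} \<and>
                        S f x = of_real (real N / h x) *
                          (\<Sum>\<^sub>\<infinity>i\<in>{N..}. of_real (h (real N / (x + real i)) / (x + real i)\<^sup>2)
                               * f (real N / (x + real i))) \<and>
                        S f x = U fhat x / of_real ((x + real N) * h x)) \<and>
                     (\<forall>n\<ge>1. AE x in \<mu>.
                        (S ^^ n) f x = (U ^^ n) fhat x / of_real ((x + real N) * h x))))))
        \<and> \<comment> \<open>(b)\<close>
          (\<forall>K. perron_frobenius unit_lebesgue (cf_map N) K \<longrightarrow>
             (\<forall>f :: real \<Rightarrow> complex. integrable unit_lebesgue f \<longrightarrow>
                (let fhat = (\<lambda>x. of_real (x + real N) * f x) in
                  (AE x in unit_lebesgue.
                     ((\<lambda>i. of_real (real N / (x + real i)\<^sup>2) * f (real N / (x + real i)))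
                        has_sum K f x) {N..}) \<and>
                  (\<forall>n\<ge>1. AE x in unit_lebesgue.
                     (K ^^ n) f x = (U ^^ n) fhat x / of_real (x + real N)))))
        \<and> \<comment> \<open>(c)\<close>
          (let f = (\<lambda>x. complex_of_real (ln ((real N + 1) / real N) * (x + real N) * h x)) in
            \<forall>n\<ge>1. \<forall>A\<in>sets unit_borel.
              complex_of_real (measure \<mu> ((cf_map N ^^ n) -` A \<inter> {0..1}))
                = (LINT x:A|cf_measure N. (U ^^ n) f x)))"
proof (intro conjI allI impI)
  note N = assms(1) and U = assms(2)
  fix f :: "real \<Rightarrow> complex" assume f: "integrable (cf_measure N) f"
  define c where "c = 1 / ln ((real N + 1) / real N)"
  have "AE x in unit_lebesgue.
      ((\<lambda>i. of_real (real N / (x + real i)\<^sup>2) * (of_real (cf_density N (cf_branch N i x)) * f (cf_branch N i x)))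
        has_sum (of_real (cf_density N x) * U f x)) {N..}"
    using U f unfolding cf_measure_eq
    by (rule cf_transfer_has_sum[OF N borel_measurable_cf_density AE_cf_density_nonneg[OF N]])
  with AE_space show "AE x in unit_lebesgue.
      ((\<lambda>i. of_real (cf_weight N i x) * f (real N / (x + real i))) has_sum U f x) {N..}"
  proof eventually_elim
    case (elim x)
    have x: "0 \<le> x" and pos: "0 < cf_density N x" using elim(1) cf_density_pos[OF N] by auto
    \<comment> \<open>The weight is the Jacobian times the ratio of the densities at the branch
      point and at x. The density at the branch point is c (x + i) / (N (x + i + 1)), so N and one
      factor x + i cancel.\<close>
    have weight: "real N / (x + real i)\<^sup>2 * cf_density N (cf_branch N i x) = cf_density N x * cf_weight N i x"
      if "i \<in> {N..}" for i
    proof -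
      have xi: "0 < x + real i" "0 < x + real N" using that x N by auto
      have "cf_branch N i x + real N = real N * (x + real i + 1) / (x + real i)"
        using xi by (simp add: field_simps)
      then show ?thesis
        unfolding cf_density_def cf_weight_def c_def[symmetric]
        using xi N by (simp add: power2_eq_square)
    qed
    have "((\<lambda>i. of_real (cf_density N x) * (of_real (cf_weight N i x) * f (cf_branch N i x)))
        has_sum (of_real (cf_density N x) * U f x)) {N..}"
      using elim(2)
    proof (rule has_sum_cong[THEN iffD1, rotated])
      fix i assume "i \<in> {N..}"
      from weight[OF this]
      show "complex_of_real (real N / (x + real i)\<^sup>2) * (of_real (cf_density N (cf_branch N i x)) * f (cf_branch N i x))
          = of_real (cf_density N x) * (of_real (cf_weight N i x) * f (cf_branch N i x))"
        by (metis mult.assoc of_real_mult)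
    qed
    then show ?case using pos by (subst (asm) has_sum_cmult_right_iff) auto
  qed
next
  note N = assms(1) and U = assms(2)
  fix \<mu> :: "real measure" and h :: "real \<Rightarrow> real"
  assume "prob_space \<mu> \<and> sets \<mu> = sets unit_borel \<and> absolutely_continuous unit_lebesgue \<mu> \<and>
    h \<in> borel_measurable unit_borel \<and>
    (AE x in unit_lebesgue. h x = enn2real (RN_deriv unit_lebesgue \<mu> x))"
  then have fin: "finite_measure \<mu>" and sets: "sets \<mu> = sets unit_lebesgue"
    and ac: "absolutely_continuous unit_lebesgue \<mu>"
    and h: "h \<in> borel_measurable unit_lebesgue"
    and hRN: "AE x in unit_lebesgue. h x = enn2real (RN_deriv unit_lebesgue \<mu> x)"
    by (auto simp: prob_space_def sets_unit_lebesgue measurable_cong_sets[OF sets_unit_lebesgue refl])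
  have \<mu>: "\<mu> = density unit_lebesgue (\<lambda>x. ennreal (h x))"
    by (rule eq_density_if_AE_eq_RN_deriv[OF sigma_finite_unit_lebesgue fin ac sets h hRN])
  have h0: "AE x in unit_lebesgue. 0 \<le> h x"
    using hRN by eventually_elim simp
  \<comment> \<open>The set where h is not positive is \<mu>-null, so every claim may be checked
    where h > 0 and division by h is legitimate.\<close>
  have AE_\<mu>: "AE x in \<mu>. P x" if "AE x in unit_lebesgue. x \<in> {0..1} \<longrightarrow> 0 < h x \<longrightarrow> P x" for P
    unfolding \<mu> using h that AE_space by (subst AE_density) (auto elim: eventually_elim2)
  {
    fix S and f :: "real \<Rightarrow> complex"
    assume S: "perron_frobenius \<mu> (cf_map N) S" and f: "integrable \<mu> f"
    let ?fhat = "\<lambda>x. of_real (x + real N) * f x * of_real (h x)"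
    let ?t = "\<lambda>x i. of_real (h (real N / (x + real i)) / (x + real i)\<^sup>2) * f (real N / (x + real i))"
    have hat: "AE x in \<mu>. (S ^^ n) f x = (U ^^ n) ?fhat x / of_real ((x + real N) * h x)" for n
    proof (rule AE_\<mu>)
      have fhat: "?fhat = (\<lambda>x. of_real (x + real N) * (of_real (h x) * f x))"
        by (simp add: fun_eq_iff)
      show "AE x in unit_lebesgue. x \<in> {0..1} \<longrightarrow> 0 < h x \<longrightarrow>
          (S ^^ n) f x = (U ^^ n) ?fhat x / of_real ((x + real N) * h x)"
        using cf_transfer_funpow_hat[OF N U h h0 S[unfolded \<mu>] f[unfolded \<mu>], of n] unfolding fhat
      proof eventually_elim
        case (elim x)
        show ?case
          \<comment> \<open>The divisor is nonzero since x + N and h x are positive; keeping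
            \<open>of_real\<close> outside the product lets this be decided over the reals.\<close>
          unfolding elim[symmetric] using N
          by (auto simp del: of_real_add of_real_mult)
      qed
    qed
    have "AE x in \<mu>. ?t x summable_on {N..} \<and> S f x = of_real (real N / h x) * (\<Sum>\<^sub>\<infinity>i\<in>{N..}. ?t x i)"
    proof (rule AE_\<mu>)
      show "AE x in unit_lebesgue. x \<in> {0..1} \<longrightarrow> 0 < h x \<longrightarrow>
          ?t x summable_on {N..} \<and> S f x = of_real (real N / h x) * (\<Sum>\<^sub>\<infinity>i\<in>{N..}. ?t x i)"
        using cf_transfer_has_sum[OF N h h0 S[unfolded \<mu>] f[unfolded \<mu>]]
      proof eventually_elim
        case (elim x)
        \<comment> \<open>Each summand contains the constant N, which is pulled out of the sum and
          reappears in the prefactor N / h.\<close>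
        have "complex_of_real (real N / (x + real i)\<^sup>2) * (of_real (h (cf_branch N i x)) * f (cf_branch N i x))
            = of_real (real N) * ?t x i" for i
          by simp
        with elim have "(?t x has_sum (of_real (h x) * S f x / of_real (real N))) {N..}"
          using N by (simp only: has_sum_cmult_right_iff of_real_eq_0_iff of_nat_eq_0_iff)
        then show ?case
          using N by (auto simp: infsumI dest: has_sum_imp_summable)
      qed
    qed
    then have "AE x in \<mu>. ?t x summable_on {N..} \<and> S f x = of_real (real N / h x) * (\<Sum>\<^sub>\<infinity>i\<in>{N..}. ?t x i) \<and>
        S f x = U ?fhat x / of_real ((x + real N) * h x)"
      \<comment> \<open>The formula for S f in terms of U is the case n = 1 of the iterated
        one.\<close>
      using hat[of 1] by eventually_elim simp
    note this and hat
  }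
  then show "let fhat = \<lambda>x. of_real (x + real N) * f x * of_real (h x) in
      (AE x in \<mu>.
        (\<lambda>i. of_real (h (real N / (x + real i)) / (x + real i)\<^sup>2)
          * f (real N / (x + real i))) summable_on {N..} \<and>
        S f x = of_real (real N / h x) *
          (\<Sum>\<^sub>\<infinity>i\<in>{N..}. of_real (h (real N / (x + real i)) / (x + real i)\<^sup>2)
            * f (real N / (x + real i))) \<and>
        S f x = U fhat x / of_real ((x + real N) * h x)) \<and>
      (\<forall>n\<ge>1. AE x in \<mu>. (S ^^ n) f x = (U ^^ n) fhat x / of_real ((x + real N) * h x))"
    if "perron_frobenius \<mu> (cf_map N) S" "integrable \<mu> f" for S and f :: "real \<Rightarrow> complex"
    using that unfolding Let_def by blast
  show "let fhat = \<lambda>x. of_real (x + real N) * f x in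
      (AE x in unit_lebesgue.
        ((\<lambda>i. of_real (real N / (x + real i)\<^sup>2) * f (real N / (x + real i))) has_sum K f x) {N..}) \<and>
      (\<forall>n\<ge>1. AE x in unit_lebesgue. (K ^^ n) f x = (U ^^ n) fhat x / of_real (x + real N))"
    if K: "perron_frobenius unit_lebesgue (cf_map N) K" and f: "integrable unit_lebesgue f"
    for K and f :: "real \<Rightarrow> complex"
  proof -
    \<comment> \<open>Part (b) is the weight w = 1: Lebesgue measure is written as a density over
      itself so that the general lemmas apply to K.\<close>
    have 1: "density unit_lebesgue (\<lambda>x. ennreal 1) = unit_lebesgue"
      by (simp add: density_1)
    have hat: "AE x in unit_lebesgue. of_real ((x + real N) * 1) * (K ^^ n) f x
        = (U ^^ n) (\<lambda>x. of_real (x + real N) * (of_real 1 * f x)) x" for n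
      by (rule cf_transfer_funpow_hat[OF N U]) (use K f 1 in auto)
    have "AE x in unit_lebesgue. (K ^^ n) f x = (U ^^ n) (\<lambda>x. of_real (x + real N) * f x) x / of_real (x + real N)" for n
      using AE_space hat[of n]
    proof eventually_elim
      case (elim x)
      have "complex_of_real (x + real N) \<noteq> 0"
        using elim(1) N by (simp del: of_real_add)
      with elim(2) show ?case
        by (simp add: eq_divide_eq mult.commute del: of_real_add)
    qed
    moreover have "AE x in unit_lebesgue.
        ((\<lambda>i. of_real (real N / (x + real i)\<^sup>2) * f (real N / (x + real i))) has_sum K f x) {N..}"
      using cf_transfer_has_sum[OF N, of "\<lambda>_. 1" K f] K f unfolding 1 by simp
    ultimately show ?thesis unfolding Let_def by blast
  qed
  show "let f = \<lambda>x. complex_of_real (ln ((real N + 1) / real N) * (x + real N) * h x) in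
      \<forall>n\<ge>1. \<forall>A\<in>sets unit_borel.
        complex_of_real (measure \<mu> ((cf_map N ^^ n) -` A \<inter> {0..1}))
          = (LINT x:A|cf_measure N. (U ^^ n) f x)"
    unfolding Let_def using measure_eq_cf_transfer_funpow[OF N U h h0 \<mu> fin] by blast
qed

end
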